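(* Let $P_0$ (null) and $P_1$ (alternative) be probability distributions of an observation $X$. Let $\varphi_1$ be a real-valued target function and $\mathbf{a}=(a_1,\dots,a_q)^{\top}$ a vector of real-valued augmenting functions, such that $\varphi_1(X)$ and all $a_j(X)$ have finite second moments under $P_0$ and finite first moments under $P_1$. Assume $\mathbb{E}_{P_0}[\mathbf{a}(X)]=\mathbf{0}$ and that $\mathbf{F}=\operatorname{Cov}_{P_0}(\mathbf{a})$ is invertible, and put $\mathbf{b}=\operatorname{Cov}_{P_0}(\mathbf{a},\varphi_1)$ and $\mathbf{K}_0=-\mathbf{F}^{-1}\mathbf{b}\in\mathbb{R}^q$. Let $\tau_1=\mathbb{E}_{P_1}[\varphi_1(X)]$ be the target value under the alternative and $\boldsymbol{\mu}_{a,H_1}=\mathbb{E}_{P_1}[\mathbf{a}(X)]$. For an i.i.d. sample of size $N\ge 1$, let $\widehat{\tau}=\bar\varphi_1+\mathbf{K}_0^{\top}\bar{\mathbf{a}}$, where bars denote sample means. Then for i.i.d. data from $P_1$, $$\mathbb{E}_{P_1}[\widehat{\tau}]=\tau_1+\mathbf{K}_0^{\top}\boldsymbol{\mu}_{a,H_1}.$$ Consequently $\mathbb{E}_{P_1}[\widehat{\tau}]=\tau_1$ if and only if $\mathbf{K}_0^{\top}\boldsymbol{\mu}_{a,H_1}=0$. In particular, the condition that every augmenting function has mean zero under $P_1$ (i.e. $\boldsymbol{\mu}_{a,H_1}=\mathbf{0}$) is sufficient for $\mathbb{E}_{P_1}[\widehat{\tau}]=\tau_1$, but it is not necessary: there exist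 probability distributions $P_0,P_1$, a real-valued function $\varphi_1$ and a vector $\mathbf{a}$ of real-valued functions, with $\varphi_1(X)$ and all $a_j(X)$ having finite second moments under $P_0$ and finite first moments under $P_1$, with $\mathbb{E}_{P_0}[\mathbf{a}(X)]=\mathbf{0}$ and $\operatorname{Cov}_{P_0}(\mathbf{a})$ invertible, such that $\boldsymbol{\mu}_{a,H_1}\neq\mathbf{0}$ and $\mathbb{E}_{P_1}[\widehat{\tau}]=\tau_1$.
   Context: The statistic $\widehat{\tau}$ is called an $H_0$-centered augmentation of the target statistic $\bar\varphi_1$: the augmenting (control-variate) functions have mean zero under the null distribution, and the weight vector $\mathbf{K}_0$ is the null-variance-minimizing ("null-optimized") weight vector. $\operatorname{Cov}_{P_0}(\mathbf{a})$ is the $q\times q$ covariance matrix of $\mathbf{a}(X)$ under $P_0$, and $\operatorname{Cov}_{P_0}(\mathbf{a},\varphi_1)$ is the vector with entries $\operatorname{Cov}_{P_0}(a_j(X),\varphi_1(X))$. *)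

theory Defs
  imports "HOL-Probability.Probability"
begin

definition cov :: "'x measure \<Rightarrow> ('x \<Rightarrow> real) \<Rightarrow> ('x \<Rightarrow> real) \<Rightarrow> real" where
  "cov P f g = (\<integral>x. (f x - (\<integral>y. f y \<partial>P)) * (g x - (\<integral>y. g y \<partial>P)) \<partial>P)"

definition mean_vec :: "'x measure \<Rightarrow> ('x \<Rightarrow> real ^ 'q) \<Rightarrow> real ^ 'q" where
  "mean_vec P a = (\<chi> j. \<integral>x. a x $ j \<partial>P)"

definition cov_mat :: "'x measure \<Rightarrow> ('x \<Rightarrow> real ^ 'q) \<Rightarrow> real ^ 'q ^ 'q" where
  "cov_mat P a = (\<chi> i j. cov P (\<lambda>x. a x $ i) (\<lambda>x. a x $ j))"

definition cov_vec :: "'x measure \<Rightarrow> ('x \<Rightarrow> real ^ 'q) \<Rightarrow> ('x \<Rightarrow> real) \<Rightarrow> real ^ 'q" where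
  "cov_vec P a \<phi> = (\<chi> j. cov P (\<lambda>x. a x $ j) \<phi>)"

definition null_weight :: "'x measure \<Rightarrow> ('x \<Rightarrow> real) \<Rightarrow> ('x \<Rightarrow> real ^ 'q) \<Rightarrow> real ^ 'q" where
  "null_weight P0 \<phi> a = - (matrix_inv (cov_mat P0 a) *v cov_vec P0 a \<phi>)"

text \<open>The null and the alternative are distributions of the same observation, hence live on
  the same measurable space; measurability with respect to \<open>P0\<close> is thus measurability with
  respect to \<open>P1\<close>.\<close>

definition H0_centered :: "'x measure \<Rightarrow> 'x measure \<Rightarrow> ('x \<Rightarrow> real) \<Rightarrow> ('x \<Rightarrow> real ^ 'q) \<Rightarrow> bool" where
  "H0_centered P0 P1 \<phi> a \<longleftrightarrow>
     prob_space P0 \<and> prob_space P1 \<and> sets P1 = sets P0 \<and>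
     \<phi> \<in> borel_measurable P0 \<and> (\<forall>j. (\<lambda>x. a x $ j) \<in> borel_measurable P0) \<and>
     integrable P0 (\<lambda>x. (\<phi> x)\<^sup>2) \<and> (\<forall>j. integrable P0 (\<lambda>x. (a x $ j)\<^sup>2)) \<and>
     integrable P1 \<phi> \<and> (\<forall>j. integrable P1 (\<lambda>x. a x $ j)) \<and>
     mean_vec P0 a = 0 \<and> invertible (cov_mat P0 a)"

definition iid_sample :: "'w measure \<Rightarrow> 'x measure \<Rightarrow> nat \<Rightarrow> (nat \<Rightarrow> 'w \<Rightarrow> 'x) \<Rightarrow> bool" where
  "iid_sample S P N X \<longleftrightarrow>
     prob_space S \<and> prob_space.indep_vars S (\<lambda>_. P) X {..<N} \<and> (\<forall>i<N. distr S P (X i) = P)"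

definition sample_mean :: "nat \<Rightarrow> (nat \<Rightarrow> 'w \<Rightarrow> 'x) \<Rightarrow> ('x \<Rightarrow> 'b::real_vector) \<Rightarrow> 'w \<Rightarrow> 'b" where
  "sample_mean N X f \<omega> = (\<Sum>i<N. f (X i \<omega>)) /\<^sub>R real N"

definition tau_hat ::
  "'x measure \<Rightarrow> ('x \<Rightarrow> real) \<Rightarrow> ('x \<Rightarrow> real ^ 'q) \<Rightarrow> nat \<Rightarrow> (nat \<Rightarrow> 'w \<Rightarrow> 'x) \<Rightarrow> 'w \<Rightarrow> real" where
  "tau_hat P0 \<phi> a N X \<omega> = sample_mean N X \<phi> \<omega> + null_weight P0 \<phi> a \<bullet> sample_mean N X a \<omega>"

end

theory Submission
  imports Defs
begin

text \<open>The expectation formula is linearity of the expectation. A mean vector that does not vanish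
  can still be orthogonal to the weight vector; this happens for every alternative if the target is
  uncorrelated with the augmenting functions under the null, since then the weight vector is 0.
  The counterexample takes the constant target 0, \<open>a\<close> the identity, the null uniform on the unit
  vectors \<open>\<plusminus>e\<^sub>j\<close> (with covariance matrix \<open>I/q\<close>) and a point mass as the alternative.\<close>

text \<open>Each \<open>X i\<close> has law \<open>P\<close>, so \<open>f (X i)\<close> has the
  integral of \<open>f\<close>, and averaging keeps this common value. Using
  \<open>has_bochner_integral\<close> carries integrability and the value through the linearity
  rules together.\<close>

lemma has_bochner_integral_sample_mean:
  fixes f :: "'x \<Rightarrow> real"
  assumes iid: "iid_sample S P N X" and N: "1 \<le> N" and f: "integrable P f"
  shows "has_bochner_integral S (sample_mean N X f) (\<integral>x. f x \<partial>P)"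
proof -
  interpret S: prob_space S
    using iid by (simp add: iid_sample_def)
  have "has_bochner_integral S (\<lambda>\<omega>. f (X i \<omega>)) (\<integral>x. f x \<partial>P)" if "i < N" for i
  proof -
    have meas: "X i \<in> measurable S P" and distr: "distr S P (X i) = P"
      using iid that by (auto simp: iid_sample_def S.indep_vars_def)
    have "integrable S (\<lambda>\<omega>. f (X i \<omega>))"
      using integrable_distr[OF meas] f distr by simp
    moreover have "(\<integral>\<omega>. f (X i \<omega>) \<partial>S) = (\<integral>x. f x \<partial>P)"
      using integral_distr[OF meas borel_measurable_integrable[OF f]] distr by simp
    ultimately show ?thesis
      by (simp add: has_bochner_integral_iff)
  qed
  then have "has_bochner_integral S (\<lambda>\<omega>. \<Sum>i<N. f (X i \<omega>)) (\<Sum>i<N. \<integral>x. f x \<partial>P)"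
    by (intro has_bochner_integral_sum) auto
  from has_bochner_integral_scaleR_right[OF this, of "inverse (real N)"]
  have "has_bochner_integral S (sample_mean N X f)
      (inverse (real N) * (real N * (\<integral>x. f x \<partial>P)))"
    by (simp add: sample_mean_def [abs_def])
  \<comment> \<open>Here \<open>1 \<le> N\<close> matters: for \<open>N = 0\<close> the sample mean
    is 0 by the convention \<open>inverse 0 = 0\<close>.\<close>
  moreover have "inverse (real N) * (real N * (\<integral>x. f x \<partial>P)) = (\<integral>x. f x \<partial>P)"
    using N by (simp add: field_simps)
  ultimately show ?thesis
    by simp
qed

lemma sample_mean_nth:
  "sample_mean N X a \<omega> $ j = sample_mean N X (\<lambda>x. a x $ j) \<omega>"
  by (simp add: sample_mean_def)

text \<open>The inner product is expanded into coordinates, so that the scalar lemma on sample means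
  applies to the target and to each augmenting function.\<close>

lemma has_bochner_integral_tau_hat:
  assumes "integrable P \<phi>" and "\<And>j. integrable P (\<lambda>x. a x $ j)"
    and "iid_sample S P N X" and "1 \<le> N"
  shows "has_bochner_integral S (tau_hat P0 \<phi> a N X)
           ((\<integral>x. \<phi> x \<partial>P) + null_weight P0 \<phi> a \<bullet> mean_vec P a)"
  unfolding tau_hat_def [abs_def] inner_vec_def sample_mean_nth mean_vec_def inner_real_def
  using assms
  by (auto intro!: has_bochner_integral_add has_bochner_integral_sum
      has_bochner_integral_mult_right has_bochner_integral_sample_mean)

text \<open>Samples of every positive size exist, so the unbiasedness claimed for all samples in the
  counterexample is not vacuous.\<close>

lemma iid_sample_coordinates:
  assumes P: "prob_space P" and N: "1 \<le> N"
  shows "iid_sample (\<Pi>\<^sub>M i\<in>{..<N}. P) P N (\<lambda>i \<omega>. \<omega> i)"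
proof -
  let ?S = "\<Pi>\<^sub>M i\<in>{..<N}. P"
  interpret S: prob_space ?S
    by (intro prob_space_PiM P)
  have distr: "distr ?S P (\<lambda>\<omega>. \<omega> i) = P" if "i < N" for i
    using that distr_PiM_component[of "{..<N}" "\<lambda>_. P" i] P by simp
  \<comment> \<open>Points of the product space are extensional, so restriction to
    \<open>{..<N}\<close> fixes them. The joint law of the coordinates is therefore the product of
    their marginals, which characterizes independence for a nonempty index set.\<close>
  have "distr ?S ?S (\<lambda>\<omega>. \<lambda>i\<in>{..<N}. \<omega> i) = distr ?S ?S (\<lambda>\<omega>. \<omega>)"
    by (rule distr_cong) (auto simp: space_PiM)
  also have "\<dots> = (\<Pi>\<^sub>M i\<in>{..<N}. distr ?S P (\<lambda>\<omega>. \<omega> i))"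
    by (subst distr_id, rule PiM_cong) (simp_all add: distr)
  finally have "S.indep_vars (\<lambda>_. P) (\<lambda>i \<omega>. \<omega> i) {..<N}"
    using N by (subst S.indep_vars_iff_distr_eq_PiM') (auto simp: lessThan_empty_iff)
  then show ?thesis
    by (simp add: iid_sample_def S.prob_space_axioms distr)
qed

text \<open>Drawing an index and a sign uniformly turns every integral into a finite sum over the
  indices with two terms each.\<close>

definition signed_axis_pmf :: "(real ^ 'q) pmf" where
  "signed_axis_pmf = map_pmf (\<lambda>(k, s). axis k s) (pmf_of_set (UNIV \<times> {1, - 1}))"

lemma integral_signed_axis_pmf:
  fixes f :: "real ^ 'q \<Rightarrow> real"
  shows "(\<integral>x. f x \<partial>signed_axis_pmf)
    = (\<Sum>k\<in>UNIV. f (axis k 1) + f (axis k (- 1))) / (2 * real CARD('q))"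
proof -
  have "(\<Sum>p\<in>UNIV \<times> {1, - 1 :: real}. f (case p of (k, s) \<Rightarrow> axis k s))
    = (\<Sum>k\<in>UNIV. \<Sum>s\<in>{1, - 1}. f (axis k s))"
    by (subst sum.cartesian_product) (simp add: case_prod_unfold)
  then show ?thesis
    by (simp add: signed_axis_pmf_def integral_pmf_of_set card_cartesian_product mult.commute)
qed

lemma integrable_signed_axis_pmf:
  fixes f :: "real ^ 'q \<Rightarrow> real"
  shows "integrable signed_axis_pmf f"
  by (rule integrable_measure_pmf_finite) (simp add: signed_axis_pmf_def set_pmf_of_set)

text \<open>Opposite signs cancel.\<close>

lemma mean_vec_signed_axis_pmf:
  "mean_vec signed_axis_pmf (\<lambda>x :: real ^ 'q. x) = 0"
proof -
  have "axis k 1 $ i + axis k (- 1) $ i = (0 :: real)" for i k :: 'q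
    by (simp add: axis_def)
  then show ?thesis
    by (simp add: mean_vec_def vec_eq_iff integral_signed_axis_pmf)
qed

text \<open>An axis vector has only one nonzero coordinate, so mixed products vanish; on the
  diagonal, 2 of the 2q equally likely points contribute 1 each.\<close>

lemma cov_mat_signed_axis_pmf:
  "cov_mat signed_axis_pmf (\<lambda>x :: real ^ 'q. x) = (1 / real CARD('q)) *\<^sub>R mat 1"
proof -
  have "cov signed_axis_pmf (\<lambda>x :: real ^ 'q. x $ i) (\<lambda>x. x $ j)
    = (if i = j then 1 / real CARD('q) else 0)" for i j
  proof -
    have mean: "(\<integral>x. (x :: real ^ 'q) $ l \<partial>signed_axis_pmf) = 0" for l
      using mean_vec_signed_axis_pmf[where 'q = 'q] by (simp add: mean_vec_def vec_eq_iff)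
    have "(\<Sum>k\<in>UNIV. (axis k 1 :: real ^ 'q) $ i * axis k 1 $ j
        + axis k (- 1) $ i * axis k (- 1) $ j) = (\<Sum>k\<in>UNIV. if k = i then (if i = j then 2 else 0) else 0)"
      by (rule sum.cong) (auto simp: axis_def)
    then show ?thesis
      by (simp add: cov_def mean integral_signed_axis_pmf)
  qed
  then show ?thesis
    by (simp add: cov_mat_def mat_def vec_eq_iff)
qed

text \<open>Both distributions have finite support, so every function is integrable and
  \<open>\<phi>\<close> and \<open>c\<close> can be arbitrary. The covariance matrix is a nonzero
  multiple of the identity.\<close>

lemma H0_centered_signed_axis_pmf:
  fixes \<phi> :: "real ^ 'q \<Rightarrow> real"
  shows "H0_centered signed_axis_pmf (return_pmf c) \<phi> (\<lambda>x. x)"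
proof -
  have "invertible (mat 1 :: real ^ 'q ^ 'q)"
    unfolding invertible_def by (intro exI[of _ "mat 1"]) simp
  then have "invertible (cov_mat signed_axis_pmf (\<lambda>x :: real ^ 'q. x))"
    by (simp only: cov_mat_signed_axis_pmf) (rule scalar_invertible, simp_all)
  then show ?thesis
    unfolding H0_centered_def
    by (auto simp: prob_space_measure_pmf integrable_signed_axis_pmf mean_vec_signed_axis_pmf
        intro: integrable_measure_pmf_finite)
qed

lemma null_weight_zero_target: "null_weight P (\<lambda>_. 0) a = 0"
  by (simp add: null_weight_def cov_vec_def cov_def flip: zero_vec_def)

theorem mainTheorem1:
  shows "(\<forall>(P0 :: 'x measure) (P1 :: 'x measure) (\<phi> :: 'x \<Rightarrow> real) (a :: 'x \<Rightarrow> real ^ 'q)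
             (N :: nat) (S :: 'w measure) (X :: nat \<Rightarrow> 'w \<Rightarrow> 'x).
            H0_centered P0 P1 \<phi> a \<and> 1 \<le> N \<and> iid_sample S P1 N X \<longrightarrow>
              integrable S (tau_hat P0 \<phi> a N X) \<and>
              (\<integral>\<omega>. tau_hat P0 \<phi> a N X \<omega> \<partial>S)
                = (\<integral>x. \<phi> x \<partial>P1) + null_weight P0 \<phi> a \<bullet> mean_vec P1 a \<and>
              ((\<integral>\<omega>. tau_hat P0 \<phi> a N X \<omega> \<partial>S) = (\<integral>x. \<phi> x \<partial>P1)
                \<longleftrightarrow> null_weight P0 \<phi> a \<bullet> mean_vec P1 a = 0) \<and>
              (mean_vec P1 a = 0
                \<longrightarrow> (\<integral>\<omega>. tau_hat P0 \<phi> a N X \<omega> \<partial>S) = (\<integral>x. \<phi> x \<partial>P1)))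
       \<and> (\<exists>(P0 :: (real ^ 'q) measure) (P1 :: (real ^ 'q) measure)
             (\<phi> :: real ^ 'q \<Rightarrow> real) (a :: real ^ 'q \<Rightarrow> real ^ 'q).
            H0_centered P0 P1 \<phi> a \<and> mean_vec P1 a \<noteq> 0 \<and>
            (\<forall>N\<ge>1.
              (\<exists>(S :: (nat \<Rightarrow> real ^ 'q) measure) X. iid_sample S P1 N X) \<and>
              (\<forall>(S :: (nat \<Rightarrow> real ^ 'q) measure) X. iid_sample S P1 N X \<longrightarrow>
                 integrable S (tau_hat P0 \<phi> a N X) \<and>
                 (\<integral>\<omega>. tau_hat P0 \<phi> a N X \<omega> \<partial>S) = (\<integral>x. \<phi> x \<partial>P1))))"
proof (rule conjI, goal_cases)
  case 1
  show ?case
  proof (intro allI impI, elim conjE)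
    fix P0 P1 :: "'x measure" and \<phi> :: "'x \<Rightarrow> real" and a :: "'x \<Rightarrow> real ^ 'q"
      and N :: nat and S :: "'w measure" and X :: "nat \<Rightarrow> 'w \<Rightarrow> 'x"
    assume H: "H0_centered P0 P1 \<phi> a" and "1 \<le> N" "iid_sample S P1 N X"
    with has_bochner_integral_tau_hat[of P1 \<phi> a S N X P0]
    have "has_bochner_integral S (tau_hat P0 \<phi> a N X)
        ((\<integral>x. \<phi> x \<partial>P1) + null_weight P0 \<phi> a \<bullet> mean_vec P1 a)"
      by (simp add: H0_centered_def)
    then show "integrable S (tau_hat P0 \<phi> a N X) \<and>
        (\<integral>\<omega>. tau_hat P0 \<phi> a N X \<omega> \<partial>S)
          = (\<integral>x. \<phi> x \<partial>P1) + null_weight P0 \<phi> a \<bullet> mean_vec P1 a \<and>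
        ((\<integral>\<omega>. tau_hat P0 \<phi> a N X \<omega> \<partial>S) = (\<integral>x. \<phi> x \<partial>P1)
          \<longleftrightarrow> null_weight P0 \<phi> a \<bullet> mean_vec P1 a = 0) \<and>
        (mean_vec P1 a = 0 \<longrightarrow> (\<integral>\<omega>. tau_hat P0 \<phi> a N X \<omega> \<partial>S) = (\<integral>x. \<phi> x \<partial>P1))"
      by (auto simp: has_bochner_integral_iff)
  qed
next
  case 2
  define P0 :: "(real ^ 'q) measure" where "P0 = signed_axis_pmf"
  \<comment> \<open>The point 1 of \<open>real ^ 'q\<close> is the all-ones vector, so every
    coordinate of the alternative mean is 1.\<close>
  define P1 :: "(real ^ 'q) measure" where "P1 = return_pmf 1"
  define \<phi> :: "real ^ 'q \<Rightarrow> real" where "\<phi> = (\<lambda>_. 0)"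
  define a :: "real ^ 'q \<Rightarrow> real ^ 'q" where "a = (\<lambda>x. x)"
  have H: "H0_centered P0 P1 \<phi> a"
    unfolding P0_def P1_def a_def by (rule H0_centered_signed_axis_pmf)
  have mean: "mean_vec P1 a \<noteq> 0"
    by (simp add: P1_def a_def mean_vec_def vec_eq_iff)
  \<comment> \<open>The product measure lives on functions from \<open>nat\<close>, which is the
    type of sample space demanded by the existence claim.\<close>
  have sample: "iid_sample (\<Pi>\<^sub>M i\<in>{..<N}. P1) P1 N (\<lambda>i \<omega>. \<omega> i)" if "1 \<le> N" for N
    using that H by (intro iid_sample_coordinates) (auto simp: H0_centered_def)
  have unbiased: "integrable S (tau_hat P0 \<phi> a N X) \<and>
      (\<integral>\<omega>. tau_hat P0 \<phi> a N X \<omega> \<partial>S) = (\<integral>x. \<phi> x \<partial>P1)"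
    if "1 \<le> N" "iid_sample S P1 N X" for N and S :: "(nat \<Rightarrow> real ^ 'q) measure" and X
  proof -
    \<comment> \<open>With weight 0 the bias term vanishes although the alternative mean does
      not.\<close>
    have "null_weight P0 \<phi> a = 0"
      by (simp add: \<phi>_def null_weight_zero_target)
    then show ?thesis
      using has_bochner_integral_tau_hat[of P1 \<phi> a S N X P0] that H
      by (simp add: H0_centered_def has_bochner_integral_iff)
  qed
  show ?case
    using H mean sample unbiased by blast
qed

end
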